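(* Let $A$ be a dendriform algebra over a field $k$ of characteristic zero, augmented by a unit as in the context, and let $a\in A$. Then for every $n\ge 1$, $$w^{(n)}_{\succ}(a)=\sum_{\substack{i_1+\cdots+i_k=n\\ i_1,\ldots,i_k>0}}\frac{\ell^{(i_1)}(a)*\cdots*\ell^{(i_k)}(a)}{i_1(i_1+i_2)\cdots(i_1+\cdots+i_k)},$$ $$w^{(n)}_{\prec}(a)=\sum_{\substack{i_1+\cdots+i_k=n\\ i_1,\ldots,i_k>0}}\frac{r^{(i_k)}(a)*\cdots*r^{(i_1)}(a)}{i_1(i_1+i_2)\cdots(i_1+\cdots+i_k)}.$$
   Context: A dendriform algebra over $k$ is a $k$-vector space $A$ with bilinear operations $\prec,\succ$ satisfying $(a\prec b)\prec c=a\prec(b*c)$, $(a\succ b)\prec c=a\succ(b\prec c)$, $a\succ(b\succ c)=(a*b)\succ c$, where $a*b:=a\prec b+a\succ b$ (associative). Adjoin a unit $1$ with $a\prec 1:=a$, $1\succ a:=a$, $1\prec a:=0$, $a\succ 1:=0$. Set $w^{(0)}_\prec(a)=w^{(0)}_\succ(a)=1$, $w^{(n)}_\prec(a):=a\prec w^{(n-1)}_\prec(a)$, $w^{(n)}_\succ(a):=w^{(n-1)}_\succ(a)\succ a$. Define the pre-Lie products $a\rhd b:=a\succ b-b\prec a$ and $a\lhd b:=a\prec b-b\succ a$, and $\ell^{(1)}(a)=r^{(1)}(a):=a$, $\ell^{(n+1)}(a):=\ell^{(n)}(a)\rhd a$, $r^{(n+1)}(a):=a\lhd r^{(n)}(a)$.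 *)

theory Defs
  imports Complex_Main "HOL-Library.Product_Plus"
begin

locale dendriform_algebra = vector_space scale
  for scale :: "'k::field \<Rightarrow> 'a::ab_group_add \<Rightarrow> 'a" (infixr "*s" 75) +
  fixes prec :: "'a \<Rightarrow> 'a \<Rightarrow> 'a" (infix "\<prec>" 70)
    and succ :: "'a \<Rightarrow> 'a \<Rightarrow> 'a" (infix "\<succ>" 70)
  assumes prec_linear_left: "Vector_Spaces.linear scale scale (\<lambda>a. a \<prec> b)"
    and prec_linear_right: "Vector_Spaces.linear scale scale (\<lambda>b. a \<prec> b)"
    and succ_linear_left: "Vector_Spaces.linear scale scale (\<lambda>a. a \<succ> b)"
    and succ_linear_right: "Vector_Spaces.linear scale scale (\<lambda>b. a \<succ> b)"
    and prec_prec: "(a \<prec> b) \<prec> c = a \<prec> (b \<prec> c + b \<succ> c)"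
    and succ_prec: "(a \<succ> b) \<prec> c = a \<succ> (b \<prec> c)"
    and succ_succ: "a \<succ> (b \<succ> c) = (a \<prec> b + a \<succ> b) \<succ> c"
begin

definition star :: "'a \<Rightarrow> 'a \<Rightarrow> 'a" (infixl "\<star>" 70) where
  "a \<star> b = a \<prec> b + a \<succ> b"

definition rhd :: "'a \<Rightarrow> 'a \<Rightarrow> 'a" (infix "\<rhd>" 70) where
  "a \<rhd> b = a \<succ> b - b \<prec> a"

definition lhd :: "'a \<Rightarrow> 'a \<Rightarrow> 'a" (infix "\<lhd>" 70) where
  "a \<lhd> b = a \<prec> b - b \<succ> a"

text \<open>Both iterated pre-Lie products start at exponent one; the value at exponent zero is
  left unspecified.\<close>

fun lpow :: "nat \<Rightarrow> 'a \<Rightarrow> 'a" where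
  "lpow (Suc 0) a = a"
| "lpow (Suc (Suc n)) a = lpow (Suc n) a \<rhd> a"

fun rpow :: "nat \<Rightarrow> 'a \<Rightarrow> 'a" where
  "rpow (Suc 0) a = a"
| "rpow (Suc (Suc n)) a = a \<lhd> rpow (Suc n) a"

text \<open>The augmented space $k 1 \oplus A$ is the type of pairs, with $(\lambda, a)$ standing for
  $\lambda 1 + a$. The half-products are extended by bilinearity from $a \prec 1 = a$,
  $1 \succ a = a$, $1 \prec a = 0$, $a \succ 1 = 0$. No value is prescribed for $1 \prec 1$ and
  $1 \succ 1$, so the half-products are unspecified when both scalar parts are nonzero. The
  associative product is nevertheless total, with $1$ as its unit.\<close>

definition aug_emb :: "'a \<Rightarrow> 'k \<times> 'a" where
  "aug_emb a = (0, a)"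

definition aug_one :: "'k \<times> 'a" where
  "aug_one = (1, 0)"

definition aug_scale :: "'k \<Rightarrow> 'k \<times> 'a \<Rightarrow> 'k \<times> 'a" where
  "aug_scale c x = (c * fst x, c *s snd x)"

definition aug_prec :: "'k \<times> 'a \<Rightarrow> 'k \<times> 'a \<Rightarrow> 'k \<times> 'a" where
  "aug_prec x y = (if fst x = 0 \<or> fst y = 0
     then (0, fst y *s snd x + snd x \<prec> snd y) else undefined)"

definition aug_succ :: "'k \<times> 'a \<Rightarrow> 'k \<times> 'a \<Rightarrow> 'k \<times> 'a" where
  "aug_succ x y = (if fst x = 0 \<or> fst y = 0
     then (0, fst x *s snd y + snd x \<succ> snd y) else undefined)"

definition aug_star :: "'k \<times> 'a \<Rightarrow> 'k \<times> 'a \<Rightarrow> 'k \<times> 'a" where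
  "aug_star x y = (fst x * fst y, fst x *s snd y + fst y *s snd x + snd x \<star> snd y)"

definition aug_star_list :: "('k \<times> 'a) list \<Rightarrow> 'k \<times> 'a" where
  "aug_star_list xs = foldr aug_star xs aug_one"

primrec w_prec :: "nat \<Rightarrow> 'a \<Rightarrow> 'k \<times> 'a" where
  "w_prec 0 a = aug_one"
| "w_prec (Suc n) a = aug_prec (aug_emb a) (w_prec n a)"

primrec w_succ :: "nat \<Rightarrow> 'a \<Rightarrow> 'k \<times> 'a" where
  "w_succ 0 a = aug_one"
| "w_succ (Suc n) a = aug_succ (w_succ n a) (aug_emb a)"

lemma half_products_zero [simp]:
  "0 \<prec> b = 0" "a \<prec> 0 = 0" "0 \<succ> b = 0" "a \<succ> 0 = 0"
  using prec_linear_left[of b] prec_linear_right[of a]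
    succ_linear_left[of b] succ_linear_right[of a]
  by (auto simp: Vector_Spaces.linear_def dest: module_hom.zero)

lemma aug_unit_rules:
  "aug_prec (aug_emb a) aug_one = aug_emb a"
  "aug_succ aug_one (aug_emb a) = aug_emb a"
  "aug_prec aug_one (aug_emb a) = aug_emb 0"
  "aug_succ (aug_emb a) aug_one = aug_emb 0"
  by (simp_all add: aug_prec_def aug_succ_def aug_emb_def aug_one_def)

lemma aug_emb_rules:
  "aug_prec (aug_emb a) (aug_emb b) = aug_emb (a \<prec> b)"
  "aug_succ (aug_emb a) (aug_emb b) = aug_emb (a \<succ> b)"
  "aug_star (aug_emb a) (aug_emb b) = aug_emb (a \<star> b)"
  by (simp_all add: aug_prec_def aug_succ_def aug_star_def aug_emb_def)

lemma aug_star_one: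
  "aug_star aug_one x = x" "aug_star x aug_one = x"
  by (simp_all add: aug_star_def aug_one_def star_def)

lemma aug_star_eq:
  assumes "fst x = 0 \<or> fst y = 0"
  shows "aug_star x y = aug_prec x y + aug_succ x y"
  using assms by (auto simp: aug_star_def aug_prec_def aug_succ_def star_def)

end

definition compositions :: "nat \<Rightarrow> nat list set" where
  "compositions n = {xs. (\<forall>i\<in>set xs. 0 < i) \<and> sum_list xs = n}"

text \<open>For $xs = [i_1, \ldots, i_k]$ this is $i_1 (i_1 + i_2) \cdots (i_1 + \cdots + i_k)$.\<close>

definition partial_sums_prod :: "nat list \<Rightarrow> nat" where
  "partial_sums_prod xs = (\<Prod>j = 1..length xs. sum_list (take j xs))"

lemma finite_compositions: "finite (compositions n)"
proof (rule finite_subset)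
  show "compositions n \<subseteq> {xs. set xs \<subseteq> {..n} \<and> length xs \<le> n}"
  proof
    fix xs assume "xs \<in> compositions n"
    then have pos: "\<forall>i\<in>set xs. 0 < i" and s: "sum_list xs = n"
      by (auto simp: compositions_def)
    from pos have "length xs \<le> sum_list xs" by (induction xs) auto
    with s show "xs \<in> {xs. set xs \<subseteq> {..n} \<and> length xs \<le> n}"
      by (auto dest: member_le_sum_list)
  qed
  show "finite {xs. set xs \<subseteq> {..n} \<and> length xs \<le> n}"
    by (rule finite_lists_length_le) simp
qed

end

(* With w(n) the n-th \<succ>-power of a, everything rests on the recursion
   n w(n) = w(n-1) * l(1) + ... + w(0) * l(n), proved by induction on n. In the sum for n+1, write
   l(i+1) = l(i) \<succ> a - a \<prec> l(i): since (x * y) \<succ> a = x \<succ> (y \<succ> a) and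
   x \<succ> (a \<prec> y) = (x \<succ> a) \<prec> y, the terms with last operation \<succ> a add up to
   (n w(n)) \<succ> a + w(n) \<succ> a = (n+1) w(n+1), and the rest telescopes. Dividing by n and iterating,
   the last part of a composition is the index of the summand. The formula for the \<prec>-powers is the
   same statement in the opposite dendriform algebra. *)
theory Submission
  imports Defs
begin

text \<open>The last partial sum is the total, so appending a part that completes a composition of n
  multiplies the denominator by n.\<close>

lemma partial_sums_prod_snoc:
  "partial_sums_prod (xs @ [i]) = partial_sums_prod xs * (sum_list xs + i)"
  by (simp add: partial_sums_prod_def)

lemma compositions_0: "compositions 0 = {[]}"
proof -
  have "xs = []" if "\<forall>i\<in>set xs. 0 < i" "sum_list xs = 0" for xs :: "nat list"
    using that by (cases xs) auto
  then show ?thesis by (auto simp: compositions_def)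
qed

text \<open>Splits off the last part. Writing it as \<open>Suc i\<close> builds in its
  positivity.\<close>

lemma sum_compositions_snoc:
  assumes "n > 0"
  shows "(\<Sum>xs\<in>compositions n. f xs) =
    (\<Sum>i<n. \<Sum>xs\<in>compositions (n - Suc i). f (xs @ [Suc i]))"
proof -
  have "(\<Sum>i<n. \<Sum>xs\<in>compositions (n - Suc i). f (xs @ [Suc i])) =
      (\<Sum>(i, xs)\<in>(SIGMA i:{..<n}. compositions (n - Suc i)). f (xs @ [Suc i]))"
    by (intro sum.Sigma) (auto simp: finite_compositions)
  also have "\<dots> = (\<Sum>xs\<in>compositions n. f xs)"
  proof (rule sum.reindex_bij_witness
      [where i = "\<lambda>xs. (last xs - 1, butlast xs)" and j = "\<lambda>(i, xs). xs @ [Suc i]"])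
    fix ys assume ys: "ys \<in> compositions n"
    \<comment> \<open>Only 0 has the empty composition, so for n > 0 there is a last part to
      remove.\<close>
    with assms have "ys \<noteq> []" by (auto simp: compositions_def)
    then obtain zs i where [simp]: "ys = zs @ [i]" by (metis append_butlast_last_id)
    from ys have "i > 0" "sum_list zs + i = n" "\<forall>j\<in>set zs. 0 < j"
      by (auto simp: compositions_def)
    then show "(case (last ys - 1, butlast ys) of (i, xs) \<Rightarrow> xs @ [Suc i]) = ys"
      "(last ys - 1, butlast ys) \<in> (SIGMA i:{..<n}. compositions (n - Suc i))"
      by (auto simp: compositions_def)
  qed (auto simp: compositions_def)
  finally show ?thesis ..
qed

context dendriform_algebra
begin

lemma half_products_bilinear:
  "(x + y) \<prec> z = x \<prec> z + y \<prec> z" "x \<prec> (y + z) = x \<prec> y + x \<prec> z"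
  "(x + y) \<succ> z = x \<succ> z + y \<succ> z" "x \<succ> (y + z) = x \<succ> y + x \<succ> z"
  "(c *s x) \<prec> z = c *s (x \<prec> z)" "x \<prec> (c *s z) = c *s (x \<prec> z)"
  "(c *s x) \<succ> z = c *s (x \<succ> z)" "x \<succ> (c *s z) = c *s (x \<succ> z)"
  "x \<prec> (y - z) = x \<prec> y - x \<prec> z" "x \<succ> (y - z) = x \<succ> y - x \<succ> z"
proof -
  interpret pl: Vector_Spaces.linear scale scale "\<lambda>x. x \<prec> z" by (rule prec_linear_left)
  interpret pr: Vector_Spaces.linear scale scale "\<lambda>z. x \<prec> z" by (rule prec_linear_right)
  interpret sl: Vector_Spaces.linear scale scale "\<lambda>x. x \<succ> z" by (rule succ_linear_left)
  interpret sr: Vector_Spaces.linear scale scale "\<lambda>z. x \<succ> z" by (rule succ_linear_right)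
  show "(x + y) \<prec> z = x \<prec> z + y \<prec> z" "x \<prec> (y + z) = x \<prec> y + x \<prec> z"
    "(x + y) \<succ> z = x \<succ> z + y \<succ> z" "x \<succ> (y + z) = x \<succ> y + x \<succ> z"
    by (rule pl.add pr.add sl.add sr.add)+
  show "(c *s x) \<prec> z = c *s (x \<prec> z)" "x \<prec> (c *s z) = c *s (x \<prec> z)"
    "(c *s x) \<succ> z = c *s (x \<succ> z)" "x \<succ> (c *s z) = c *s (x \<succ> z)"
    by (rule pl.scale pr.scale sl.scale sr.scale)+
  show "x \<prec> (y - z) = x \<prec> y - x \<prec> z" "x \<succ> (y - z) = x \<succ> y - x \<succ> z"
    by (rule pr.diff sr.diff)+
qed

text \<open>Adding up the three dendriform axioms gives associativity.\<close>

lemma star_assoc: "(x \<star> y) \<star> z = x \<star> (y \<star> z)"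
  by (simp add: star_def half_products_bilinear prec_prec succ_prec succ_succ algebra_simps)

lemma vector_space_aug_scale: "vector_space aug_scale"
  by unfold_locales (auto simp: aug_scale_def algebra_simps scale_left_distrib scale_right_distrib)

lemma aug_star_assoc: "aug_star (aug_star x y) z = aug_star x (aug_star y z)"
  using star_assoc[of "snd x" "snd y" "snd z"]
  by (simp add: aug_star_def star_def half_products_bilinear algebra_simps)

lemma aug_star_list_snoc: "aug_star_list (xs @ [x]) = aug_star (aug_star_list xs) x"
  by (induction xs) (simp_all add: aug_star_list_def aug_star_one aug_star_assoc)

lemma module_hom_aug_star_left: "module_hom aug_scale aug_scale (\<lambda>x. aug_star x y)"
proof -
  interpret aug: vector_space aug_scale by (rule vector_space_aug_scale)
  show ?thesis
    by unfold_locales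
      (simp_all add: aug_scale_def aug_star_def star_def half_products_bilinear algebra_simps)
qed

text \<open>A right factor in A has scalar part 0, which avoids the unspecified
  \<open>1 \<succ> 1\<close>; hence linearity on the whole augmented space.\<close>

lemma module_hom_aug_succ_emb:
  "module_hom aug_scale aug_scale (\<lambda>x. aug_succ x (aug_emb b))"
proof -
  interpret aug: vector_space aug_scale by (rule vector_space_aug_scale)
  show ?thesis
    by unfold_locales
      (simp_all add: aug_scale_def aug_succ_def aug_emb_def half_products_bilinear algebra_simps)
qed

lemma aug_star_emb:
  "aug_star x (aug_emb b) = aug_prec x (aug_emb b) + aug_succ x (aug_emb b)"
  by (rule aug_star_eq) (simp add: aug_emb_def)

text \<open>This extends \<open>succ_succ\<close> to a left factor with a scalar part; for the unit
  both sides are \<open>b \<succ> c\<close>.\<close>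

lemma aug_succ_star_emb:
  "aug_succ (aug_star x (aug_emb b)) (aug_emb c) = aug_succ x (aug_emb (b \<succ> c))"
  using succ_succ[of "snd x" b c]
  by (simp add: aug_succ_def aug_star_def aug_emb_def half_products_bilinear star_def)

text \<open>Prepares the telescoping: for x = w(m) and b = l(i), the factor
  \<open>x \<succ> a\<close> is w(m+1), so both \<prec>-terms have the form w(j) \<prec> l(k) with
  the same j + k.\<close>

lemma aug_star_rhd:
  "aug_star x (aug_emb (b \<rhd> a)) = aug_succ (aug_star x (aug_emb b)) (aug_emb a)
    + aug_prec x (aug_emb (b \<rhd> a)) - aug_prec (aug_succ x (aug_emb a)) (aug_emb b)"
  by (simp only: aug_succ_star_emb aug_star_emb[of x "b \<rhd> a"])
    (simp add: rhd_def aug_succ_def aug_prec_def aug_emb_def half_products_bilinear succ_prec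
      scale_right_diff_distrib)

lemma of_nat_w_succ:
  "aug_scale (of_nat n) (w_succ n a) =
    (\<Sum>i<n. aug_star (w_succ (n - Suc i) a) (aug_emb (lpow (Suc i) a)))"
proof (induction n)
  case 0
  show ?case by (simp add: aug_scale_def zero_prod_def)
next
  case (Suc n)
  let ?P = "\<lambda>i. aug_prec (w_succ (n - i) a) (aug_emb (lpow (Suc i) a))"
  \<comment> \<open>The bound i < n gives n - i = \<open>Suc (n - Suc i)\<close>, so that w(n-i-1)
    \<succ> a is w(n-i).\<close>
  have step: "aug_star (w_succ (n - Suc i) a) (aug_emb (lpow (Suc (Suc i)) a)) =
      aug_succ (aug_star (w_succ (n - Suc i) a) (aug_emb (lpow (Suc i) a))) (aug_emb a)
      + ?P (Suc i) - ?P i" if "i < n" for i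
    using that Suc_diff_Suc[OF that]
    by (simp add: aug_star_rhd flip: w_succ.simps(2))
  \<comment> \<open>The upper end \<open>?P n\<close> is 1 \<prec> l(n+1) = 0.\<close>
  have tele: "(\<Sum>i<n. ?P (Suc i) - ?P i) = - ?P 0"
    by (subst sum_lessThan_telescope[of ?P])
      (simp add: aug_prec_def aug_emb_def aug_one_def zero_prod_def)
  \<comment> \<open>The summand i = 0 is set apart, since l(1) = a is not a pre-Lie product. It
    equals w(n) \<prec> a + w(n) \<succ> a: the first term cancels - \<open>?P 0\<close>, the second
    is w(n+1).\<close>
  have "(\<Sum>i<Suc n. aug_star (w_succ (Suc n - Suc i) a) (aug_emb (lpow (Suc i) a))) =
      aug_star (w_succ n a) (aug_emb a)
      + (\<Sum>i<n. aug_star (w_succ (n - Suc i) a) (aug_emb (lpow (Suc (Suc i)) a)))"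
    by (simp add: sum.lessThan_Suc_shift del: sum.lessThan_Suc)
  also have "(\<Sum>i<n. aug_star (w_succ (n - Suc i) a) (aug_emb (lpow (Suc (Suc i)) a))) =
      (\<Sum>i<n. aug_succ (aug_star (w_succ (n - Suc i) a) (aug_emb (lpow (Suc i) a))) (aug_emb a))
      + (\<Sum>i<n. ?P (Suc i) - ?P i)"
    unfolding sum.distrib[symmetric] by (rule sum.cong) (simp_all only: step lessThan_iff add_diff_eq)
  also have "(\<Sum>i<n. aug_succ (aug_star (w_succ (n - Suc i) a) (aug_emb (lpow (Suc i) a)))
      (aug_emb a)) = aug_succ (aug_scale (of_nat n) (w_succ n a)) (aug_emb a)"
    unfolding Suc.IH by (simp only: module_hom.sum[OF module_hom_aug_succ_emb])
  also have "\<dots> = aug_scale (of_nat n) (w_succ (Suc n) a)"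
    by (simp add: module_hom.scale[OF module_hom_aug_succ_emb])
  finally show ?case
    unfolding tele by (simp add: aug_star_emb aug_scale_def scale_left_distrib algebra_simps
        prod_eq_iff)
qed

text \<open>The locale allows any field, so characteristic zero enters as a hypothesis, used to
  divide the recursion by n.\<close>

lemma w_succ_eq_sum_compositions:
  assumes "\<And>m. m > 0 \<Longrightarrow> of_nat m \<noteq> (0 :: 'k)"
  shows "w_succ n a = (\<Sum>xs\<in>compositions n. aug_scale (1 / of_nat (partial_sums_prod xs))
    (aug_star_list (map (\<lambda>i. aug_emb (lpow i a)) xs)))"
proof (induction n rule: less_induct)
  case (less n)
  interpret aug: vector_space aug_scale by (rule vector_space_aug_scale)
  let ?t = "\<lambda>xs. aug_scale (1 / of_nat (partial_sums_prod xs))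
    (aug_star_list (map (\<lambda>i. aug_emb (lpow i a)) xs))"
  show ?case
  proof (cases "n = 0")
    case True
    then show ?thesis
      by (simp add: compositions_0 partial_sums_prod_def aug_star_list_def)
  next
    case False
    then have n: "n > 0" by simp
    \<comment> \<open>The factor 1/n from the recursion becomes the last factor of the denominator,
      as the extended list sums to n.\<close>
    have snoc: "aug_scale (1 / of_nat n) (aug_star (?t xs) (aug_emb (lpow (Suc i) a))) =
        ?t (xs @ [Suc i])" if "i < n" "xs \<in> compositions (n - Suc i)" for i xs
    proof -
      from that have "sum_list xs + Suc i = n" by (simp add: compositions_def)
      then have "partial_sums_prod (xs @ [Suc i]) = partial_sums_prod xs * n"
        by (simp only: partial_sums_prod_snoc)
      then show ?thesis
        by (simp add: aug_star_list_snoc module_hom.scale[OF module_hom_aug_star_left] mult.commute)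
    qed
    have "w_succ n a = aug_scale (1 / of_nat n) (aug_scale (of_nat n) (w_succ n a))"
      using assms[OF n] by simp
    also have "\<dots> = (\<Sum>i<n. aug_scale (1 / of_nat n)
        (aug_star (w_succ (n - Suc i) a) (aug_emb (lpow (Suc i) a))))"
      by (simp only: of_nat_w_succ aug.scale_sum_right)
    also have "\<dots> = (\<Sum>i<n. \<Sum>xs\<in>compositions (n - Suc i). ?t (xs @ [Suc i]))"
      by (intro sum.cong refl)
        (simp add: less n module_hom.sum[OF module_hom_aug_star_left] aug.scale_sum_right snoc)
    also have "\<dots> = (\<Sum>xs\<in>compositions n. ?t xs)"
      by (rule sum_compositions_snoc[OF n, symmetric])
    finally show ?thesis .
  qed
qed

text \<open>Reversing the arguments and exchanging the half-products swaps \<open>prec_prec\<close>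
  with \<open>succ_succ\<close> and turns \<open>succ_prec\<close> into itself read
  backwards.\<close>

lemma opposite: "dendriform_algebra scale (\<lambda>x y. y \<succ> x) (\<lambda>x y. y \<prec> x)"
proof (intro dendriform_algebra.intro dendriform_algebra_axioms.intro vector_space_axioms
    prec_linear_left prec_linear_right succ_linear_left succ_linear_right succ_prec[symmetric])
  fix x y z
  show "z \<succ> (y \<succ> x) = (z \<succ> y + z \<prec> y) \<succ> x"
    by (simp only: succ_succ add.commute)
  show "(z \<prec> y) \<prec> x = z \<prec> (y \<succ> x + y \<prec> x)"
    by (simp only: prec_prec add.commute)
qed

lemma w_prec_eq_sum_compositions:
  assumes "\<And>m. m > 0 \<Longrightarrow> of_nat m \<noteq> (0 :: 'k)"
  shows "w_prec n a = (\<Sum>xs\<in>compositions n. aug_scale (1 / of_nat (partial_sums_prod xs))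
    (aug_star_list (map (\<lambda>i. aug_emb (rpow i a)) (rev xs))))"
proof -
  interpret op: dendriform_algebra scale "\<lambda>x y. y \<succ> x" "\<lambda>x y. y \<prec> x"
    by (rule opposite)
  have w: "op.w_succ n a = w_prec n a" for n
    by (induction n) (auto simp: op.aug_succ_def aug_prec_def)
  have star: "op.aug_star x y = aug_star y x" for x y
    by (simp add: op.aug_star_def aug_star_def op.star_def star_def algebra_simps)
  \<comment> \<open>The associative product of the opposite algebra is reversed, hence the
    \<open>rev\<close> in the formula.\<close>
  have list: "op.aug_star_list xs = aug_star_list (rev xs)" for xs
    by (induction xs) (simp_all add: aug_star_list_snoc op.aug_star_list_def star,
        simp add: aug_star_list_def)
  \<comment> \<open>At exponent 0 both powers are unspecified; the parts of a composition are
    positive, so this case never occurs.\<close>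
  have pow: "op.lpow i a = rpow i a" if "i > 0" for i
    using that
  proof (induction i a rule: rpow.induct)
    case (2 n a)
    then show ?case by (simp add: op.rhd_def lhd_def)
  qed simp_all
  have "map (\<lambda>i. aug_emb (op.lpow i a)) xs = map (\<lambda>i. aug_emb (rpow i a)) xs"
    if "xs \<in> compositions n" for xs
    using that by (auto simp: compositions_def pow)
  with op.w_succ_eq_sum_compositions[OF assms, of n a] show ?thesis
    by (simp add: w list rev_map cong: sum.cong)
qed

end

theorem theorem3p2:
  fixes scale :: "'k::field_char_0 \<Rightarrow> 'a::ab_group_add \<Rightarrow> 'a"
    and prec succ :: "'a \<Rightarrow> 'a \<Rightarrow> 'a"
    and a :: 'a and n :: nat
  assumes "dendriform_algebra scale prec succ"
    and "n \<ge> 1"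
  shows "dendriform_algebra.w_succ scale succ n a =
      (\<Sum>xs\<in>compositions n.
         dendriform_algebra.aug_scale scale (1 / of_nat (partial_sums_prod xs))
           (dendriform_algebra.aug_star_list scale prec succ
              (map (\<lambda>i. dendriform_algebra.aug_emb (dendriform_algebra.lpow prec succ i a)) xs)))
    \<and> dendriform_algebra.w_prec scale prec n a =
      (\<Sum>xs\<in>compositions n.
         dendriform_algebra.aug_scale scale (1 / of_nat (partial_sums_prod xs))
           (dendriform_algebra.aug_star_list scale prec succ
              (map (\<lambda>i. dendriform_algebra.aug_emb (dendriform_algebra.rpow prec succ i a)) (rev xs))))"
proof -
  interpret dendriform_algebra scale prec succ by fact
  show ?thesis
    \<comment> \<open>The class \<open>field_char_0\<close> discharges the hypotheses on
      \<open>of_nat\<close>.\<close>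
    by (intro conjI w_succ_eq_sum_compositions w_prec_eq_sum_compositions) simp_all
qed

end
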